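(* Let $R$ be a Noetherian $F$-finite and $F$-split ring of characteristic $p>0$ which is either local, or a $\mathbb Z_{\ge0}$-graded ring $R=\bigoplus_{n\ge0}R_n$ with $(R_0,\mathfrak m_0)$ local and $R=R_0[R_1]$ finitely generated over $R_0$. If $\mathbb I=\{I_n\}_{n\ge0}$ is an $F$-split filtration of ideals of $R$, then the Rees algebra $\mathcal{R}(\mathbb I)$ and the associated graded algebra $\mathrm{gr}(\mathbb I)$ are $F$-split.
   Context: A ring $A$ of characteristic $p$ is $F$-finite if it is a finitely generated module over itself via the Frobenius $F$, and $F$-split if $F:A\to A$ is a split monomorphism. For a reduced ring $A$, $A^{1/p}$ is the ring of $p$-th roots of elements of $A$ (inside the total ring of fractions' $p$-th roots), and a splitting is an $A$-linear map $\phi:A^{1/p}\to A$ with $\phi|_A=\mathrm{id}_A$; for an ideal $I$, $I^{1/p}=\{f^{1/p}\mid f\in I\}\subseteq A^{1/p}$. An $F$-split filtration is a sequence of ideals $\mathbb I=\{I_n\}_{n\ge0}$ of $R$ with $I_0=R$, $I_{n+1}\subseteq I_n$ and $I_nI_m\subseteq I_{n+m}$ for all $n,m\ge0$, such that there is a splitting $\phi:R^{1/p}\to R$ with $\phi\big((I_{np+1})^{1/p}\big)\subseteq I_{n+1}$ for every $n\ge0$. In the graded case all objects (ideals, maps) are assumed homogeneous. $\mathcal{R}(\mathbb I)=\bigoplus_{n\ge0}I_nT^n\subseteq R[T]$ ($T$ a variable) and $\mathrm{gr}(\mathbb I)=\bigoplus_{n\ge0}I_n/I_{n+1}$. *)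

theory Defs
  imports "HOL-Algebra.Algebra"
begin

section \<open>Modules\<close>

definition regular_module :: "('a, 'm) ring_scheme \<Rightarrow> ('a, 'a) module" where
  "regular_module A =
     \<lparr>carrier = carrier A, monoid.mult = monoid.mult A, monoid.one = monoid.one A,
      ring.zero = ring.zero A, ring.add = ring.add A, smult = monoid.mult A\<rparr>"

definition linear_map ::
  "('a, 'm) ring_scheme \<Rightarrow> ('a, 'b, 'n) module_scheme \<Rightarrow> ('a, 'c, 'k) module_scheme
     \<Rightarrow> ('b \<Rightarrow> 'c) \<Rightarrow> bool" where
  "linear_map A M N \<phi> \<longleftrightarrow>
     \<phi> \<in> carrier M \<rightarrow> carrier N \<and>
     (\<forall>x\<in>carrier M. \<forall>y\<in>carrier M. \<phi> (x \<oplus>\<^bsub>M\<^esub> y) = \<phi> x \<oplus>\<^bsub>N\<^esub> \<phi> y) \<and>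
     (\<forall>a\<in>carrier A. \<forall>x\<in>carrier M. \<phi> (a \<odot>\<^bsub>M\<^esub> x) = a \<odot>\<^bsub>N\<^esub> \<phi> x)"

definition fin_gen_module :: "('a, 'm) ring_scheme \<Rightarrow> ('a, 'b, 'n) module_scheme \<Rightarrow> bool" where
  "fin_gen_module A M \<longleftrightarrow>
     (\<exists>B \<subseteq> carrier M. finite B \<and>
        (\<forall>x\<in>carrier M. \<exists>c \<in> B \<rightarrow> carrier A. x = (\<Oplus>\<^bsub>M\<^esub>b\<in>B. c b \<odot>\<^bsub>M\<^esub> b)))"

section \<open>Rings of characteristic \<open>p\<close> and the Frobenius map\<close>

definition has_char :: "nat \<Rightarrow> ('a, 'm) ring_scheme \<Rightarrow> bool" where
  "has_char p A \<longleftrightarrow> (\<forall>n::nat. add_pow A n \<one>\<^bsub>A\<^esub> = \<zero>\<^bsub>A\<^esub> \<longleftrightarrow> p dvd n)"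

text \<open>\<open>A\<close> regarded as an \<open>A\<close>-module through the Frobenius map \<open>F a = a\<^sup>p\<close>.\<close>

definition frob_module :: "nat \<Rightarrow> ('a, 'm) ring_scheme \<Rightarrow> ('a, 'a) module" where
  "frob_module p A =
     \<lparr>carrier = carrier A, monoid.mult = monoid.mult A, monoid.one = monoid.one A,
      ring.zero = ring.zero A, ring.add = ring.add A, smult = (\<lambda>a x. a [^]\<^bsub>A\<^esub> p \<otimes>\<^bsub>A\<^esub> x)\<rparr>"

definition F_finite :: "nat \<Rightarrow> ('a, 'm) ring_scheme \<Rightarrow> bool" where
  "F_finite p A \<longleftrightarrow> fin_gen_module A (frob_module p A)"

text \<open>The Frobenius map, as an \<open>A\<close>-linear map from \<open>A\<close> to \<open>frob_module p A\<close>, has an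
  \<open>A\<close>-linear left inverse. The zero ring is allowed: the associated graded ring of the
  constant filtration \<open>I\<^sub>n = R\<close> is zero.\<close>

definition F_split :: "nat \<Rightarrow> ('a, 'm) ring_scheme \<Rightarrow> bool" where
  "F_split p A \<longleftrightarrow>
     (\<exists>\<phi>. linear_map A (frob_module p A) (regular_module A) \<phi> \<and>
          (\<forall>x\<in>carrier A. \<phi> (x [^]\<^bsub>A\<^esub> p) = x))"

section \<open>The ring of \<open>p\<close>-th roots\<close>

text \<open>For reduced \<open>R\<close> of characteristic \<open>p\<close>, taking \<open>p\<close>-th roots is a ring isomorphism from
  \<open>R\<close> to \<open>R\<^sup>1\<^sup>/\<^sup>p\<close>. So \<open>R\<^sup>1\<^sup>/\<^sup>p\<close> is modelled by formal roots, with \<open>Proot f\<close> standing for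
  \<open>f\<^sup>1\<^sup>/\<^sup>p\<close>, and the inclusion of \<open>R\<close> becomes \<open>a \<mapsto> (a\<^sup>p)\<^sup>1\<^sup>/\<^sup>p\<close>. The lemmas
  \<open>proot_ring_is_ring_of_roots\<close> and \<open>proot_ring_unique\<close> below show that this is the ring of
  \<open>p\<close>-th roots, up to a unique isomorphism over \<open>R\<close>.\<close>

datatype 'a proot = Proot (proot_base: 'a)

definition proot_emb :: "nat \<Rightarrow> ('a, 'm) ring_scheme \<Rightarrow> 'a \<Rightarrow> 'a proot" where
  "proot_emb p R a = Proot (a [^]\<^bsub>R\<^esub> p)"

definition proot_ring :: "nat \<Rightarrow> ('a, 'm) ring_scheme \<Rightarrow> ('a, 'a proot) module" where
  "proot_ring p R =
     \<lparr>carrier = Proot ` carrier R,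
      monoid.mult = (\<lambda>u v. Proot (proot_base u \<otimes>\<^bsub>R\<^esub> proot_base v)),
      monoid.one = Proot \<one>\<^bsub>R\<^esub>,
      ring.zero = Proot \<zero>\<^bsub>R\<^esub>,
      ring.add = (\<lambda>u v. Proot (proot_base u \<oplus>\<^bsub>R\<^esub> proot_base v)),
      smult = (\<lambda>a u. Proot (proot_base (proot_emb p R a) \<otimes>\<^bsub>R\<^esub> proot_base u))\<rparr>"

definition splitting :: "nat \<Rightarrow> ('a, 'm) ring_scheme \<Rightarrow> ('a proot \<Rightarrow> 'a) \<Rightarrow> bool" where
  "splitting p R \<phi> \<longleftrightarrow>
     linear_map R (proot_ring p R) (regular_module R) \<phi> \<and>
     (\<forall>a\<in>carrier R. \<phi> (proot_emb p R a) = a)"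

section \<open>Filtrations\<close>

definition ideal_filtration :: "('a, 'm) ring_scheme \<Rightarrow> (nat \<Rightarrow> 'a set) \<Rightarrow> bool" where
  "ideal_filtration R I \<longleftrightarrow>
     (\<forall>n. ideal (I n) R) \<and> I 0 = carrier R \<and> (\<forall>n. I (n + 1) \<subseteq> I n) \<and>
     (\<forall>n m. ideal_prod R (I n) (I m) \<subseteq> I (n + m))"

definition splits_filtration :: "nat \<Rightarrow> (nat \<Rightarrow> 'a set) \<Rightarrow> ('a proot \<Rightarrow> 'a) \<Rightarrow> bool" where
  "splits_filtration p I \<phi> \<longleftrightarrow> (\<forall>n. \<phi> ` (Proot ` I (n * p + 1)) \<subseteq> I (n + 1))"

definition F_split_filtration :: "nat \<Rightarrow> ('a, 'm) ring_scheme \<Rightarrow> (nat \<Rightarrow> 'a set) \<Rightarrow> bool" where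
  "F_split_filtration p R I \<longleftrightarrow>
     ideal_filtration R I \<and> (\<exists>\<phi>. splitting p R \<phi> \<and> splits_filtration p I \<phi>)"

section \<open>Local and graded rings\<close>

definition local_ring :: "('a, 'm) ring_scheme \<Rightarrow> bool" where
  "local_ring R \<longleftrightarrow> cring R \<and> (\<exists>!M. maximalideal M R)"

definition graded_ring :: "('a, 'm) ring_scheme \<Rightarrow> (nat \<Rightarrow> 'a set) \<Rightarrow> bool" where
  "graded_ring R G \<longleftrightarrow>
     ring R \<and> (\<forall>n. additive_subgroup (G n) R) \<and>
     (\<forall>n m. \<forall>x\<in>G n. \<forall>y\<in>G m. x \<otimes>\<^bsub>R\<^esub> y \<in> G (n + m)) \<and>
     (\<forall>x\<in>carrier R. \<exists>!c. (\<forall>n. c n \<in> G n) \<and> finite {n. c n \<noteq> \<zero>\<^bsub>R\<^esub>} \<and>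
        x = (\<Oplus>\<^bsub>R\<^esub>n\<in>{n. c n \<noteq> \<zero>\<^bsub>R\<^esub>}. c n))"

definition standard_graded_local :: "('a, 'm) ring_scheme \<Rightarrow> (nat \<Rightarrow> 'a set) \<Rightarrow> bool" where
  "standard_graded_local R G \<longleftrightarrow>
     graded_ring R G \<and> local_ring (R\<lparr>carrier := G 0\<rparr>) \<and>
     generate_ring R (G 0 \<union> G 1) = carrier R \<and>
     (\<exists>S \<subseteq> carrier R. finite S \<and> generate_ring R (G 0 \<union> S) = carrier R)"

definition homogeneous_ideal ::
  "('a, 'm) ring_scheme \<Rightarrow> (nat \<Rightarrow> 'a set) \<Rightarrow> 'a set \<Rightarrow> bool" where
  "homogeneous_ideal R G J \<longleftrightarrow> (\<exists>H \<subseteq> (\<Union>n. G n). J = Idl\<^bsub>R\<^esub> H)"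

text \<open>\<open>R\<^sup>1\<^sup>/\<^sup>p\<close> is graded by the multiples of \<open>1/p\<close>: if \<open>f\<close> has degree \<open>d\<close> then \<open>f\<^sup>1\<^sup>/\<^sup>p\<close> has
  degree \<open>d/p\<close>. In non-integral degrees \<open>R\<close> is zero. A splitting fixes \<open>1\<close>, so it can only be
  homogeneous of degree \<open>0\<close>.\<close>

definition homogeneous_proot_map ::
  "nat \<Rightarrow> ('a, 'm) ring_scheme \<Rightarrow> (nat \<Rightarrow> 'a set) \<Rightarrow> ('a proot \<Rightarrow> 'a) \<Rightarrow> bool" where
  "homogeneous_proot_map p R G \<phi> \<longleftrightarrow>
     (\<forall>d. \<phi> ` (Proot ` G d) \<subseteq> (if p dvd d then G (d div p) else {\<zero>\<^bsub>R\<^esub>}))"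

definition graded_F_split_filtration ::
  "nat \<Rightarrow> ('a, 'm) ring_scheme \<Rightarrow> (nat \<Rightarrow> 'a set) \<Rightarrow> (nat \<Rightarrow> 'a set) \<Rightarrow> bool" where
  "graded_F_split_filtration p R G I \<longleftrightarrow>
     ideal_filtration R I \<and> (\<forall>n. homogeneous_ideal R G (I n)) \<and>
     (\<exists>\<phi>. splitting p R \<phi> \<and> homogeneous_proot_map p R G \<phi> \<and> splits_filtration p I \<phi>)"

section \<open>The Rees algebra and the associated graded ring\<close>

definition rees_algebra :: "('a, 'm) ring_scheme \<Rightarrow> (nat \<Rightarrow> 'a set) \<Rightarrow> ('a, nat \<Rightarrow> 'a) up_ring" where
  "rees_algebra R I =
     (UP R)\<lparr>carrier := {f \<in> carrier (UP R). \<forall>n. up_ring.coeff (UP R) f n \<in> I n}\<rparr>"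

text \<open>The summand \<open>I\<^sub>n/I\<^sub>n\<^sub>+\<^sub>1\<close> is the set of cosets \<open>I\<^sub>n\<^sub>+\<^sub>1 + a\<close> with \<open>a \<in> I\<^sub>n\<close>, a subgroup of
  \<open>R/I\<^sub>n\<^sub>+\<^sub>1\<close>, and its zero is \<open>I\<^sub>n\<^sub>+\<^sub>1\<close>. The product of classes in degrees \<open>i\<close> and \<open>j\<close> is the
  class modulo \<open>I\<^sub>i\<^sub>+\<^sub>j\<^sub>+\<^sub>1\<close> of the product of representatives (\<open>assoc_graded_mult\<close> below).
  Both algebras are commutative rings: \<open>rees_algebra_cring\<close> and \<open>assoc_graded_cring\<close>.\<close>

definition assoc_graded :: "('a, 'm) ring_scheme \<Rightarrow> (nat \<Rightarrow> 'a set) \<Rightarrow> (nat \<Rightarrow> 'a set) ring" where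
  "assoc_graded R I =
     \<lparr>carrier = {x. (\<forall>n. x n \<in> (+>\<^bsub>R\<^esub>) (I (n + 1)) ` I n) \<and> finite {n. x n \<noteq> I (n + 1)}},
      monoid.mult = (\<lambda>x y n. \<Oplus>\<^bsub>R Quot I (n + 1)\<^esub>i\<in>{..n}.
        rcoset_mult R (I (n + 1)) (x i) (y (n - i))),
      monoid.one = (\<lambda>n. if n = 0 then I 1 +>\<^bsub>R\<^esub> \<one>\<^bsub>R\<^esub> else I (n + 1)),
      ring.zero = (\<lambda>n. I (n + 1)),
      ring.add = (\<lambda>x y n. x n <+>\<^bsub>R\<^esub> y n)\<rparr>"

section \<open>Justification of the models\<close>

definition reduced_ring :: "('a, 'm) ring_scheme \<Rightarrow> bool" where
  "reduced_ring R \<longleftrightarrow> (\<forall>x\<in>carrier R. \<forall>n::nat. x [^]\<^bsub>R\<^esub> n = \<zero>\<^bsub>R\<^esub> \<longrightarrow> x = \<zero>\<^bsub>R\<^esub>)"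

lemma (in cring) binomial_ring:
  assumes a: "a \<in> carrier R" and b: "b \<in> carrier R"
  shows "(a \<oplus> b) [^] (n::nat) = (\<Oplus>k\<in>{..n}. add_pow R (n choose k) (a [^] k \<otimes> b [^] (n - k)))"
proof (induction n)
  case 0
  show ?case using a b by simp
next
  case (Suc n)
  let ?t = "\<lambda>k. a [^] k \<otimes> b [^] (n - k)"
  have car: "?t k \<in> carrier R" for k using a b by simp
  have A: "(\<Oplus>k\<in>{..n}. add_pow R (n choose k) (?t k)) \<otimes> a
      = (\<Oplus>k\<in>{..n}. add_pow R (n choose k) (a [^] Suc k \<otimes> b [^] (n - k)))"
  proof (subst finsum_ldistr)
    show "(\<Oplus>i\<in>{..n}. add_pow R (n choose i) (?t i) \<otimes> a)
      = (\<Oplus>k\<in>{..n}. add_pow R (n choose k) (a [^] Suc k \<otimes> b [^] (n - k)))"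
    proof (rule finsum_cong')
      fix k
      have "add_pow R (n choose k) (?t k) \<otimes> a = add_pow R (n choose k) (?t k \<otimes> a)"
        using a car by (simp only: add_pow_ldistr)
      also have "?t k \<otimes> a = a [^] Suc k \<otimes> b [^] (n - k)"
        using a b by (simp add: m_ac)
      finally show "add_pow R (n choose k) (?t k) \<otimes> a = add_pow R (n choose k) (a [^] Suc k \<otimes> b [^] (n - k))" .
    qed (use a b in auto)
  qed (use a b in auto)
  have B: "(\<Oplus>k\<in>{..n}. add_pow R (n choose k) (?t k)) \<otimes> b
      = (\<Oplus>k\<in>{..n}. add_pow R (n choose k) (a [^] k \<otimes> b [^] (Suc n - k)))"
  proof (subst finsum_ldistr)
    show "(\<Oplus>i\<in>{..n}. add_pow R (n choose i) (?t i) \<otimes> b)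
      = (\<Oplus>k\<in>{..n}. add_pow R (n choose k) (a [^] k \<otimes> b [^] (Suc n - k)))"
    proof (rule finsum_cong')
      fix k assume k: "k \<in> {..n}"
      have "add_pow R (n choose k) (?t k) \<otimes> b = add_pow R (n choose k) (?t k \<otimes> b)"
        using b car by (simp only: add_pow_ldistr)
      also have "?t k \<otimes> b = a [^] k \<otimes> b [^] (Suc n - k)"
        using a b k by (simp add: m_assoc Suc_diff_le)
      finally show "add_pow R (n choose k) (?t k) \<otimes> b = add_pow R (n choose k) (a [^] k \<otimes> b [^] (Suc n - k))" .
    qed (use a b in auto)
  qed (use a b in auto)
  let ?u = "\<lambda>k. a [^] k \<otimes> b [^] (Suc n - k)"
  have ucar: "?u k \<in> carrier R" for k using a b by simp
  have B': "(\<Oplus>k\<in>{..n}. add_pow R (n choose k) (?u k))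
      = (\<Oplus>k\<in>{..n}. add_pow R (n choose Suc k) (?u (Suc k))) \<oplus> ?u 0"
  proof -
    have "(\<Oplus>k\<in>{..Suc n}. add_pow R (n choose k) (?u k)) = (\<Oplus>k\<in>{..n}. add_pow R (n choose k) (?u k))"
      using a b by (subst finsum_Suc) (auto simp: binomial_eq_0)
    moreover have "(\<Oplus>k\<in>{..Suc n}. add_pow R (n choose k) (?u k))
      = (\<Oplus>k\<in>{..n}. add_pow R (n choose Suc k) (?u (Suc k))) \<oplus> add_pow R (n choose 0) (?u 0)"
      using ucar by (subst finsum_Suc2) (auto simp del: nat_pow_Suc)
    ultimately show ?thesis using ucar[of 0] by simp
  qed
  have "(\<Oplus>k\<in>{..Suc n}. add_pow R (Suc n choose k) (?u k))
      = (\<Oplus>k\<in>{..n}. add_pow R (Suc n choose Suc k) (?u (Suc k))) \<oplus> add_pow R (Suc n choose 0) (?u 0)"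
    using ucar by (subst finsum_Suc2) (auto simp del: nat_pow_Suc)
  also have "add_pow R (Suc n choose 0) (?u 0) = ?u 0" using ucar[of 0] by simp
  also have "(\<Oplus>k\<in>{..n}. add_pow R (Suc n choose Suc k) (?u (Suc k)))
      = (\<Oplus>k\<in>{..n}. add_pow R (n choose k) (?u (Suc k)) \<oplus> add_pow R (n choose Suc k) (?u (Suc k)))"
    using a b by (intro finsum_cong') (auto simp: add.nat_pow_mult)
  also have "\<dots> = (\<Oplus>k\<in>{..n}. add_pow R (n choose k) (?u (Suc k)))
      \<oplus> (\<Oplus>k\<in>{..n}. add_pow R (n choose Suc k) (?u (Suc k)))"
    using a b by (intro finsum_addf) auto
  finally have C: "(\<Oplus>k\<in>{..Suc n}. add_pow R (Suc n choose k) (?u k))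
     = (\<Oplus>k\<in>{..n}. add_pow R (n choose k) (?u (Suc k)))
      \<oplus> (\<Oplus>k\<in>{..n}. add_pow R (n choose Suc k) (?u (Suc k))) \<oplus> ?u 0" .
  have "(a \<oplus> b) [^] Suc n = (a \<oplus> b) [^] n \<otimes> a \<oplus> (a \<oplus> b) [^] n \<otimes> b"
    using a b by (simp add: r_distr)
  also have "\<dots> = (\<Oplus>k\<in>{..n}. add_pow R (n choose k) (?u (Suc k))) \<oplus>
     ((\<Oplus>k\<in>{..n}. add_pow R (n choose Suc k) (?u (Suc k))) \<oplus> ?u 0)"
    unfolding Suc.IH A B B' by simp
  also have "\<dots> = (\<Oplus>k\<in>{..Suc n}. add_pow R (Suc n choose k) (?u k))"
    unfolding C using a b by (subst a_assoc) (auto intro!: finsum_closed)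
  finally show ?case .
qed

lemma (in cring) frobenius_add:
  assumes p: "Factorial_Ring.prime p" and char: "has_char p R"
    and a: "a \<in> carrier R" and b: "b \<in> carrier R"
  shows "(a \<oplus> b) [^] p = a [^] p \<oplus> b [^] p"
proof -
  let ?f = "\<lambda>k. add_pow R (p choose k) (a [^] k \<otimes> b [^] (p - k))"
  have p0: "p > 0" using p prime_gt_0_nat by blast
  have z: "?f k = \<zero>" if "k \<in> {..p} - {0, p}" for k
  proof -
    have "p dvd (p choose k)"
      using that p by (intro dvd_choose_prime) auto
    then have "add_pow R (p choose k) \<one> = \<zero>" using char by (simp add: has_char_def)
    moreover have "?f k = add_pow R (p choose k) \<one> \<otimes> (a [^] k \<otimes> b [^] (p - k))"
      using a b by (simp add: add_pow_ldistr)
    ultimately show ?thesis using a b by simp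
  qed
  have "(a \<oplus> b) [^] p = (\<Oplus>k\<in>{..p}. ?f k)" using a b by (rule binomial_ring)
  also have "\<dots> = (\<Oplus>k\<in>{0, p}. ?f k)"
    using a b z by (intro add.finprod_mono_neutral_cong_right) auto
  also have "\<dots> = a [^] p \<oplus> b [^] p"
    using a b p0 by (simp add: a_comm)
  finally show ?thesis .
qed

definition is_ring_of_roots ::
  "nat \<Rightarrow> ('a, 'm) ring_scheme \<Rightarrow> ('b, 'n) ring_scheme \<Rightarrow> ('a \<Rightarrow> 'b) \<Rightarrow> bool" where
  "is_ring_of_roots p R S \<iota> \<longleftrightarrow>
     cring S \<and> reduced_ring S \<and> \<iota> \<in> ring_hom R S \<and> inj_on \<iota> (carrier R) \<and>
     (\<forall>r\<in>carrier R. \<exists>s\<in>carrier S. s [^]\<^bsub>S\<^esub> p = \<iota> r) \<and>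
     (\<forall>s\<in>carrier S. \<exists>r\<in>carrier R. s [^]\<^bsub>S\<^esub> p = \<iota> r)"

lemma F_split_imp_reduced:
  fixes R (structure)
  assumes "cring R" and "1 < p" and split: "F_split p R"
  shows "reduced_ring R"
proof -
  interpret cring R by fact
  obtain \<phi> where lin: "linear_map R (frob_module p R) (regular_module R) \<phi>"
    and \<phi>: "\<And>x. x \<in> carrier R \<Longrightarrow> \<phi> (x [^] p) = x"
    using split by (auto simp: F_split_def)
  have c: "\<phi> \<zero> \<in> carrier R"
    and "\<And>x y. x \<in> carrier R \<Longrightarrow> y \<in> carrier R \<Longrightarrow> \<phi> (x \<oplus> y) = \<phi> x \<oplus> \<phi> y"
    using lin by (auto simp: linear_map_def frob_module_def regular_module_def)
  from this(2)[of \<zero> \<zero>] have "\<phi> (\<zero> \<oplus> \<zero>) = \<phi> \<zero> \<oplus> \<phi> \<zero>" by blast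
  with c have \<phi>0: "\<phi> \<zero> = \<zero>" by (metis l_zero zero_closed add.l_cancel_one')
  have step: "x = \<zero>" if "x \<in> carrier R" "x [^] p = \<zero>" for x
    using \<phi>[OF that(1)] that(2) \<phi>0 by simp
  have iter: "x \<in> carrier R \<Longrightarrow> x [^] (p ^ k) = \<zero> \<Longrightarrow> x = \<zero>" for x k
  proof (induction k)
    case (Suc k)
    have "(x [^] (p ^ k)) [^] p = \<zero>"
      using Suc.prems by (simp add: nat_pow_pow mult.commute)
    then show ?case using Suc.IH Suc.prems(1) step nat_pow_closed by blast
  qed simp
  show ?thesis unfolding reduced_ring_def
  proof (intro ballI allI impI)
    fix x and n :: nat assume x: "x \<in> carrier R" "x [^] n = \<zero>"
    have "n \<le> p ^ n" using \<open>1 < p\<close> by (simp add: less_imp_le)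
    then have "x [^] (p ^ n) = x [^] n \<otimes> x [^] (p ^ n - n)"
      using x(1) by (simp add: nat_pow_mult)
    then show "x = \<zero>" using x iter by simp
  qed
qed

lemma (in cring) pth_root_unique:
  assumes p: "Factorial_Ring.prime p" and char: "has_char p R" and red: "reduced_ring R"
    and s: "s \<in> carrier R" and t: "t \<in> carrier R" and eq: "s [^] p = t [^] p"
  shows "s = t"
proof -
  let ?d = "s \<ominus> t"
  have d: "?d \<in> carrier R" using s t by simp
  have st: "s = t \<oplus> ?d" using s t by (simp add: minus_eq a_ac r_neg1 r_neg)
  have "t [^] p \<oplus> ?d [^] p = t [^] p"
    using frobenius_add[OF p char t d] st eq by simp
  then have "?d [^] p = \<zero>" using t d by simp
  then have "?d = \<zero>" using red d by (auto simp: reduced_ring_def)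
  then show ?thesis using s t st by simp
qed

lemma proot_ring_cring:
  fixes R (structure)
  assumes "cring R" shows "cring (proot_ring p R)"
proof -
  interpret cring R by fact
  have neg: "\<exists>y\<in>Proot ` carrier R. Proot (proot_base y \<oplus> proot_base x) = Proot \<zero>"
    if "x \<in> Proot ` carrier R" for x
    using that by (auto intro!: bexI[of _ "\<ominus> proot_base x"] simp: l_neg)
  show ?thesis
    by (rule cringI, rule abelian_groupI, insert neg)
      (auto simp: proot_ring_def a_ac m_ac l_distr r_distr intro!: comm_monoidI)
qed

lemma proot_pow:
  fixes R (structure)
  assumes "cring R" and "f \<in> carrier R"
  shows "Proot f [^]\<^bsub>proot_ring p R\<^esub> (n::nat) = Proot (f [^]\<^bsub>R\<^esub> n)"
proof -
  interpret cring R by fact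
  interpret P: cring "proot_ring p R" using proot_ring_cring assms(1) .
  show ?thesis using assms(2) by (induction n) (auto simp: proot_ring_def)
qed

lemma proot_ring_is_ring_of_roots:
  fixes R (structure)
  assumes "cring R" and p: "Factorial_Ring.prime p" and char: "has_char p R"
    and red: "reduced_ring R"
  shows "is_ring_of_roots p R (proot_ring p R) (proot_emb p R)"
    and "a \<odot>\<^bsub>proot_ring p R\<^esub> u = proot_emb p R a \<otimes>\<^bsub>proot_ring p R\<^esub> u"
    and "f \<in> carrier R \<Longrightarrow> Proot f [^]\<^bsub>proot_ring p R\<^esub> p = proot_emb p R f"
proof -
  interpret cring R by fact
  have car: "carrier (proot_ring p R) = Proot ` carrier R" by (simp add: proot_ring_def)
  show pow: "Proot f [^]\<^bsub>proot_ring p R\<^esub> p = proot_emb p R f" if "f \<in> carrier R" for f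
    using that by (simp add: proot_pow[OF \<open>cring R\<close>] proot_emb_def)
  show "a \<odot>\<^bsub>proot_ring p R\<^esub> u = proot_emb p R a \<otimes>\<^bsub>proot_ring p R\<^esub> u"
    by (simp add: proot_ring_def)
  have "reduced_ring (proot_ring p R)"
    using red by (auto simp: reduced_ring_def car proot_pow[OF \<open>cring R\<close>])
      (auto simp: proot_ring_def)
  moreover have "proot_emb p R \<in> ring_hom R (proot_ring p R)"
    by (rule ring_hom_memI)
      (auto simp: proot_emb_def proot_ring_def nat_pow_distrib frobenius_add[OF p char])
  moreover have "inj_on (proot_emb p R) (carrier R)"
    using pth_root_unique[OF p char red] by (auto simp: inj_on_def proot_emb_def)
  ultimately show "is_ring_of_roots p R (proot_ring p R) (proot_emb p R)"
    using pow proot_ring_cring[OF \<open>cring R\<close>] unfolding is_ring_of_roots_def car by blast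
qed

lemma ring_hom_inj_has_char:
  assumes "ring R" "ring S" and h: "h \<in> ring_hom R S" and inj: "inj_on h (carrier R)"
    and char: "has_char p R"
  shows "has_char p S"
proof -
  interpret h: ring_hom_ring R S h by (intro ring_hom_ringI2 assms)
  have "h (add_pow R n \<one>\<^bsub>R\<^esub>) = add_pow S n \<one>\<^bsub>S\<^esub>" for n :: nat
    by (induction n) simp_all
  moreover have "h x = \<zero>\<^bsub>S\<^esub> \<longleftrightarrow> x = \<zero>\<^bsub>R\<^esub>" if "x \<in> carrier R" for x
    using inj that by (metis h.hom_zero h.R.zero_closed inj_onD)
  ultimately show ?thesis
    using char by (metis has_char_def h.R.add.nat_pow_closed h.R.one_closed)
qed

lemma proot_ring_unique:
  assumes "cring R" and p: "Factorial_Ring.prime p" and char: "has_char p R"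
    and roots: "is_ring_of_roots p R S \<iota>"
  shows "\<exists>g \<in> ring_iso (proot_ring p R) S. (\<forall>a\<in>carrier R. g (proot_emb p R a) = \<iota> a) \<and>
    (\<forall>h \<in> ring_hom (proot_ring p R) S. (\<forall>a\<in>carrier R. h (proot_emb p R a) = \<iota> a) \<longrightarrow>
      (\<forall>u\<in>carrier (proot_ring p R). h u = g u))"
proof -
  interpret R: cring R by fact
  interpret S: cring S using roots by (simp add: is_ring_of_roots_def)
  have hom: "\<iota> \<in> ring_hom R S" and inj: "inj_on \<iota> (carrier R)" and red: "reduced_ring S"
    and ex1: "\<And>r. r \<in> carrier R \<Longrightarrow> \<exists>s\<in>carrier S. s [^]\<^bsub>S\<^esub> p = \<iota> r"
    and ex2: "\<And>s. s \<in> carrier S \<Longrightarrow> \<exists>r\<in>carrier R. s [^]\<^bsub>S\<^esub> p = \<iota> r"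
    using roots by (auto simp: is_ring_of_roots_def)
  interpret \<iota>: ring_hom_cring R S \<iota>
    by (intro ring_hom_cringI hom R.cring_axioms S.cring_axioms)
  have charS: "has_char p S"
    using ring_hom_inj_has_char[OF R.ring_axioms S.ring_axioms hom inj char] .
  note uniq = S.pth_root_unique[OF p charS red]
  have car: "carrier (proot_ring p R) = Proot ` carrier R" by (simp add: proot_ring_def)
  define g where "g u = (SOME s. s \<in> carrier S \<and> s [^]\<^bsub>S\<^esub> p = \<iota> (proot_base u))" for u
  have g: "g (Proot r) \<in> carrier S" "g (Proot r) [^]\<^bsub>S\<^esub> p = \<iota> r" if "r \<in> carrier R" for r
    using someI_ex[of "\<lambda>s. s \<in> carrier S \<and> s [^]\<^bsub>S\<^esub> p = \<iota> r"] ex1[OF that]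
    by (auto simp: g_def)
  have gI: "g (Proot r) = s" if "r \<in> carrier R" "s \<in> carrier S" "s [^]\<^bsub>S\<^esub> p = \<iota> r" for r s
    using uniq[of "g (Proot r)" s] g that by simp
  have "g \<in> ring_hom (proot_ring p R) S"
  proof (rule ring_hom_memI)
    fix x y assume "x \<in> carrier (proot_ring p R)" "y \<in> carrier (proot_ring p R)"
    then obtain a b where ab: "x = Proot a" "y = Proot b" "a \<in> carrier R" "b \<in> carrier R"
      by (auto simp: car)
    show "g (x \<otimes>\<^bsub>proot_ring p R\<^esub> y) = g x \<otimes>\<^bsub>S\<^esub> g y"
      using ab g by (auto simp: proot_ring_def S.nat_pow_distrib intro!: gI)
    show "g (x \<oplus>\<^bsub>proot_ring p R\<^esub> y) = g x \<oplus>\<^bsub>S\<^esub> g y"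
      using ab g by (auto simp: proot_ring_def S.frobenius_add[OF p charS] intro!: gI)
  qed (use g in \<open>auto simp: car proot_ring_def intro!: gI\<close>)
  moreover have "bij_betw g (carrier (proot_ring p R)) (carrier S)"
    unfolding bij_betw_def
  proof
    show "inj_on g (carrier (proot_ring p R))"
      using g inj by (auto simp: car inj_on_def) metis
    show "g ` carrier (proot_ring p R) = carrier S"
      using g gI ex2 by (auto simp: car image_iff) metis
  qed
  moreover have "g (proot_emb p R a) = \<iota> a" if "a \<in> carrier R" for a
    using that by (auto simp: proot_emb_def intro!: gI)
  moreover have "h u = g u" if h: "h \<in> ring_hom (proot_ring p R) S"
    and e: "\<forall>a\<in>carrier R. h (proot_emb p R a) = \<iota> a" and u: "u \<in> carrier (proot_ring p R)"
  for h u
  proof -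
    interpret h: ring_hom_cring "proot_ring p R" S h
      by (intro ring_hom_cringI h proot_ring_cring R.cring_axioms S.cring_axioms)
    obtain r where r: "u = Proot r" "r \<in> carrier R" using u by (auto simp: car)
    have "h u [^]\<^bsub>S\<^esub> p = h (u [^]\<^bsub>proot_ring p R\<^esub> p)" using u by simp
    also have "\<dots> = \<iota> r"
      using r e by (simp add: proot_pow[OF \<open>cring R\<close>] proot_emb_def)
    finally show ?thesis using gI[of r "h u"] r u by simp
  qed
  ultimately show ?thesis unfolding ring_iso_def by blast
qed

lemma rees_algebra_simps:
  fixes R (structure)
  shows "carrier (rees_algebra R I) = {f \<in> up R. \<forall>n. f n \<in> I n}"
    and "f \<in> up R \<Longrightarrow> g \<in> up R \<Longrightarrow> f \<otimes>\<^bsub>rees_algebra R I\<^esub> g = (\<lambda>n. \<Oplus>i\<in>{..n}. f i \<otimes> g (n - i))"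
    and "f \<in> up R \<Longrightarrow> g \<in> up R \<Longrightarrow> f \<oplus>\<^bsub>rees_algebra R I\<^esub> g = (\<lambda>n. f n \<oplus> g n)"
    and "\<one>\<^bsub>rees_algebra R I\<^esub> = (\<lambda>n. if n = 0 then \<one> else \<zero>)"
    and "\<zero>\<^bsub>rees_algebra R I\<^esub> = (\<lambda>n. \<zero>)"
  by (auto simp: rees_algebra_def UP_def)

context
  fixes R (structure) and I
  assumes R: "cring R" and filt: "ideal_filtration R I"
begin

interpretation cring R by (rule R)

interpretation U: UP_cring R "UP R" by (unfold_locales)

lemma filtration_ideal: "ideal (I n) R"
  using filt by (simp add: ideal_filtration_def)

interpretation I: ideal "I n" R for n by (rule filtration_ideal)

lemma filtration_carrier: "a \<in> I n \<Longrightarrow> a \<in> carrier R"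
  by (rule I.a_Hcarr)

lemma filtration_mult: "a \<in> I i \<Longrightarrow> b \<in> I j \<Longrightarrow> a \<otimes> b \<in> I (i + j)"
  using filt ideal_prod.prod[of a "I i" b "I j" R]
  unfolding ideal_filtration_def by blast

lemma filtration_finsum:
  assumes "\<And>i. i \<in> A \<Longrightarrow> f i \<in> I n"
  shows "(\<Oplus>i\<in>A. f i) \<in> I n"
  using assms
proof (induction A rule: infinite_finite_induct)
  case (insert x F)
  have "f \<in> F \<rightarrow> carrier R" "f x \<in> carrier R"
    using insert.prems by (blast intro: filtration_carrier)+
  then show ?case using insert by (simp add: finsum_insert)
qed (auto simp: finsum_infinite)

lemma rees_algebra_carrier:
  "f \<in> carrier (rees_algebra R I) \<longleftrightarrow>
     (\<forall>n. f n \<in> I n) \<and> finite {n. f n \<noteq> \<zero>}"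
proof
  assume f: "f \<in> carrier (rees_algebra R I)"
  then have "f \<in> up R" by (simp add: rees_algebra_simps)
  then obtain n where "bound \<zero> n f" by blast
  then have "{n. f n \<noteq> \<zero>} \<subseteq> {..n}" by (auto simp: bound_def not_less[symmetric])
  then have "finite {n. f n \<noteq> \<zero>}" using finite_subset by blast
  with f show "(\<forall>n. f n \<in> I n) \<and> finite {n. f n \<noteq> \<zero>}"
    by (simp add: rees_algebra_simps)
next
  assume f: "(\<forall>n. f n \<in> I n) \<and> finite {n. f n \<noteq> \<zero>}"
  then obtain n where "\<forall>k\<in>{n. f n \<noteq> \<zero>}. k \<le> n" using finite_nat_set_iff_bounded_le by blast
  then have "bound \<zero> n f" by (auto simp: bound_def not_less[symmetric])
  moreover have "f \<in> UNIV \<rightarrow> carrier R" using f filtration_carrier by blast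
  ultimately have "f \<in> up R" by (auto simp: up_def)
  with f show "f \<in> carrier (rees_algebra R I)"
    by (simp only: rees_algebra_simps(1) mem_Collect_eq simp_thms)
qed

lemma rees_algebra_subcring: "subcring (carrier (rees_algebra R I)) (UP R)"
proof (rule U.P.subcringI', rule U.P.subringI)
  let ?S = "carrier (rees_algebra R I)"
  have S: "f \<in> ?S \<longleftrightarrow> f \<in> carrier (UP R) \<and> (\<forall>n. up_ring.coeff (UP R) f n \<in> I n)" for f
    by (simp add: rees_algebra_def)
  show "?S \<subseteq> carrier (UP R)" by (auto simp: S)
  show "\<one>\<^bsub>UP R\<^esub> \<in> ?S" using filt by (simp add: S ideal_filtration_def)
  fix h1 assume h1: "h1 \<in> ?S"
  show "\<ominus>\<^bsub>UP R\<^esub> h1 \<in> ?S" using h1 by (auto simp: S)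
  fix h2 assume h2: "h2 \<in> ?S"
  show "h1 \<oplus>\<^bsub>UP R\<^esub> h2 \<in> ?S" using h1 h2 by (auto simp: S)
  have "up_ring.coeff (UP R) h1 i \<otimes> up_ring.coeff (UP R) h2 (n - i) \<in> I n" if "i \<le> n" for i n
    using h1 h2 filtration_mult[of "up_ring.coeff (UP R) h1 i" i "up_ring.coeff (UP R) h2 (n - i)" "n - i"] that
    by (simp add: S)
  then show "h1 \<otimes>\<^bsub>UP R\<^esub> h2 \<in> ?S"
    using h1 h2 by (auto simp: S intro!: filtration_finsum)
qed

lemma rees_algebra_cring: "cring (rees_algebra R I)"
proof -
  have "rees_algebra R I = (UP R)\<lparr>carrier := carrier (rees_algebra R I)\<rparr>"
    by (simp add: rees_algebra_def)
  then show ?thesis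
    using rees_algebra_subcring U.P.subcring_iff[of "carrier (rees_algebra R I)"]
    by (auto simp: rees_algebra_def)
qed

lemma assoc_graded_mult:
  assumes a: "a \<in> I i" and b: "b \<in> I j"
  shows "rcoset_mult R (I (i + j + 1)) (I (i + 1) +> a) (I (j + 1) +> b) = I (i + j + 1) +> (a \<otimes> b)"
proof -
  have ca: "a \<in> carrier R" "b \<in> carrier R" using a b I.a_Hcarr by auto
  have key: "I (i + j + 1) +> (a' \<otimes> b') = I (i + j + 1) +> (a \<otimes> b)"
    if "a' \<in> I (i + 1) +> a" "b' \<in> I (j + 1) +> b" for a' b'
  proof -
    obtain h k where h: "h \<in> I (i + 1)" "a' = h \<oplus> a" and k: "k \<in> I (j + 1)" "b' = k \<oplus> b"
      using \<open>a' \<in> _\<close> \<open>b' \<in> _\<close> by (auto simp: a_r_coset_def')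
    have ch: "h \<in> carrier R" "k \<in> carrier R" using h k I.a_Hcarr by auto
    have bk: "b' \<in> I j"
      using k b filt I.a_closed[of k j b] unfolding ideal_filtration_def by (metis subsetD)
    have "h \<otimes> b' \<in> I (i + j + 1)" using filtration_mult[OF h(1) bk] by (simp add: ac_simps)
    moreover have "a \<otimes> k \<in> I (i + j + 1)" using filtration_mult[OF a k(1)] by (simp add: ac_simps)
    ultimately have "h \<otimes> b' \<oplus> a \<otimes> k \<in> I (i + j + 1)" by simp
    moreover have "a' \<otimes> b' = (h \<otimes> b' \<oplus> a \<otimes> k) \<oplus> a \<otimes> b"
      using ca ch by (simp add: h k l_distr r_distr a_ac)
    ultimately have "a' \<otimes> b' \<in> I (i + j + 1) +> (a \<otimes> b)"
      by (auto simp: a_r_coset_def')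
    then show ?thesis using a_repr_independence[of "a' \<otimes> b'" "I (i + j + 1)" "a \<otimes> b"]
      ca I.a_subgroup by simp
  qed
  have "I (i + 1) +> a \<noteq> {}" "I (j + 1) +> b \<noteq> {}"
    using I.a_rcos_self ca by blast+
  then show ?thesis using key unfolding rcoset_mult_def by auto
qed

definition symbol :: "(nat \<Rightarrow> 'a) \<Rightarrow> nat \<Rightarrow> 'a set" where
  "symbol f = (\<lambda>n. I (n + 1) +> f n)"

lemma symbol_hom:
  assumes f: "f \<in> carrier (rees_algebra R I)" and g: "g \<in> carrier (rees_algebra R I)"
  shows "symbol f \<otimes>\<^bsub>assoc_graded R I\<^esub> symbol g = symbol (f \<otimes>\<^bsub>rees_algebra R I\<^esub> g)"
    and "symbol f \<oplus>\<^bsub>assoc_graded R I\<^esub> symbol g = symbol (f \<oplus>\<^bsub>rees_algebra R I\<^esub> g)"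
    and "symbol \<one>\<^bsub>rees_algebra R I\<^esub> = \<one>\<^bsub>assoc_graded R I\<^esub>"
    and "symbol \<zero>\<^bsub>rees_algebra R I\<^esub> = \<zero>\<^bsub>assoc_graded R I\<^esub>"
proof -
  have fI: "f n \<in> I n" "g n \<in> I n" for n using f g by (auto simp: rees_algebra_carrier)
  then have c: "f n \<in> carrier R" "g n \<in> carrier R" for n using I.a_Hcarr by blast+
  have up: "f \<in> up R" "g \<in> up R" using f g by (simp_all add: rees_algebra_simps)
  show "symbol f \<oplus>\<^bsub>assoc_graded R I\<^esub> symbol g = symbol (f \<oplus>\<^bsub>rees_algebra R I\<^esub> g)"
  proof
    fix n
    have "(symbol f \<oplus>\<^bsub>assoc_graded R I\<^esub> symbol g) n = (I (n + 1) +> f n) <+> (I (n + 1) +> g n)"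
      by (simp only: assoc_graded_def symbol_def ring.simps)
    also have "\<dots> = I (n + 1) +> (f n \<oplus> g n)"
      by (rule I.a_rcos_sum[OF c(1) c(2)])
    also have "f n \<oplus> g n = (f \<oplus>\<^bsub>rees_algebra R I\<^esub> g) n"
      by (simp only: rees_algebra_simps(3)[OF up])
    finally show "(symbol f \<oplus>\<^bsub>assoc_graded R I\<^esub> symbol g) n = symbol (f \<oplus>\<^bsub>rees_algebra R I\<^esub> g) n"
      by (simp only: symbol_def)
  qed
  have z: "I n +> \<zero> = I n" for n
    by (rule I.a_rcos_const) simp
  show "symbol \<one>\<^bsub>rees_algebra R I\<^esub> = \<one>\<^bsub>assoc_graded R I\<^esub>"
    by (rule ext) (simp add: symbol_def assoc_graded_def rees_algebra_simps z)
  show "symbol \<zero>\<^bsub>rees_algebra R I\<^esub> = \<zero>\<^bsub>assoc_graded R I\<^esub>"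
    by (rule ext) (simp add: symbol_def assoc_graded_def rees_algebra_simps z)
  show "symbol f \<otimes>\<^bsub>assoc_graded R I\<^esub> symbol g = symbol (f \<otimes>\<^bsub>rees_algebra R I\<^esub> g)"
  proof
    fix n
    interpret q: ring_hom_ring R "R Quot I (n + 1)" "(+>) (I (n + 1))"
      by (rule I.rcos_ring_hom_ring)
    have "(symbol f \<otimes>\<^bsub>assoc_graded R I\<^esub> symbol g) n =
      (\<Oplus>\<^bsub>R Quot I (n + 1)\<^esub>i\<in>{..n}. I (n + 1) +> f i \<otimes> g (n - i))"
      unfolding assoc_graded_def symbol_def monoid.simps ring.simps
    proof (rule q.S.finsum_cong')
      fix i assume "i \<in> {..n}"
      then show "rcoset_mult R (I (n + 1)) (I (i + 1) +> f i) (I (n - i + 1) +> g (n - i))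
         = I (n + 1) +> f i \<otimes> g (n - i)"
        using assoc_graded_mult[OF fI(1)[of i] fI(2)[of "n - i"]] by simp
    qed (use c in \<open>auto intro!: q.hom_closed simp del: One_nat_def add_Suc_right\<close>)
    also have "\<dots> = I (n + 1) +> (\<Oplus>i\<in>{..n}. f i \<otimes> g (n - i))"
      using c by (subst q.hom_finsum) (auto simp: o_def)
    also have "\<dots> = symbol (f \<otimes>\<^bsub>rees_algebra R I\<^esub> g) n"
      by (simp only: symbol_def rees_algebra_simps(2)[OF up])
    finally show "(symbol f \<otimes>\<^bsub>assoc_graded R I\<^esub> symbol g) n = symbol (f \<otimes>\<^bsub>rees_algebra R I\<^esub> g) n" .
  qed
qed

lemma symbol_image: "symbol ` carrier (rees_algebra R I) = carrier (assoc_graded R I)"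
proof
  have z: "I n +> \<zero> = I n" for n
    by (rule I.a_rcos_const) simp
  show "symbol ` carrier (rees_algebra R I) \<subseteq> carrier (assoc_graded R I)"
  proof
    fix x assume "x \<in> symbol ` carrier (rees_algebra R I)"
    then obtain f where "f \<in> carrier (rees_algebra R I)" and x: "x = symbol f"
      by blast
    then have f: "\<And>n. f n \<in> I n" "finite {n. f n \<noteq> \<zero>}"
      by (simp_all add: rees_algebra_carrier)
    have "{n. x n \<noteq> I (n + 1)} \<subseteq> {n. f n \<noteq> \<zero>}"
      using z by (auto simp: x symbol_def)
    then show "x \<in> carrier (assoc_graded R I)"
      using f finite_subset by (auto simp: assoc_graded_def x symbol_def)
  qed
  show "carrier (assoc_graded R I) \<subseteq> symbol ` carrier (rees_algebra R I)"
  proof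
    fix x assume x: "x \<in> carrier (assoc_graded R I)"
    have "\<exists>a. a \<in> I n \<and> x n = I (n + 1) +> a \<and> (x n = I (n + 1) \<longrightarrow> a = \<zero>)" for n
    proof (cases "x n = I (n + 1)")
      case True
      then show ?thesis using z by (intro exI[of _ \<zero>]) auto
    next
      case False
      then show ?thesis using x by (auto simp: assoc_graded_def)
    qed
    then obtain f where f: "\<And>n. f n \<in> I n" "\<And>n. x n = I (n + 1) +> f n"
      "\<And>n. x n = I (n + 1) \<Longrightarrow> f n = \<zero>" by metis
    have "{n. f n \<noteq> \<zero>} \<subseteq> {n. x n \<noteq> I (n + 1)}" using f(3) by auto
    then have "f \<in> carrier (rees_algebra R I)"
      using f(1) x finite_subset by (auto simp: rees_algebra_carrier assoc_graded_def)
    moreover have "x = symbol f" using f(2) by (auto simp: symbol_def)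
    ultimately show "x \<in> symbol ` carrier (rees_algebra R I)" by blast
  qed
qed

lemma assoc_graded_cring: "cring (assoc_graded R I)"
proof -
  let ?A = "rees_algebra R I" and ?G = "assoc_graded R I"
  interpret S: cring ?A by (rule rees_algebra_cring)
  have ex: "\<exists>f. f \<in> carrier ?A \<and> x = symbol f" if "x \<in> carrier ?G" for x
    using that unfolding symbol_image[symmetric] by blast
  have cl: "symbol f \<in> carrier ?G" if "f \<in> carrier ?A" for f
    using that unfolding symbol_image[symmetric] by blast
  note one = symbol_hom(3)[OF S.zero_closed S.zero_closed, symmetric]
  note zero = symbol_hom(4)[OF S.zero_closed S.zero_closed, symmetric]
  note hom = symbol_hom(1,2) cl
  show ?thesis
  proof (rule cringI)
    show "abelian_group ?G"
    proof (rule abelian_groupI)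
      fix x assume "x \<in> carrier ?G"
      then obtain f where f: "f \<in> carrier ?A" "x = symbol f" using ex by blast
      show "\<exists>y\<in>carrier ?G. y \<oplus>\<^bsub>?G\<^esub> x = \<zero>\<^bsub>?G\<^esub>"
        unfolding zero
        by (rule bexI[of _ "symbol (\<ominus>\<^bsub>?A\<^esub> f)"]) (simp_all add: f hom S.l_neg)
      show "\<zero>\<^bsub>?G\<^esub> \<oplus>\<^bsub>?G\<^esub> x = x" unfolding zero by (simp add: f hom)
    next
      fix x y z assume "x \<in> carrier ?G" "y \<in> carrier ?G" "z \<in> carrier ?G"
      then obtain f g h where f: "f \<in> carrier ?A" "x = symbol f" "g \<in> carrier ?A" "y = symbol g"
        "h \<in> carrier ?A" "z = symbol h" using ex by meson
      show "x \<oplus>\<^bsub>?G\<^esub> y \<oplus>\<^bsub>?G\<^esub> z = x \<oplus>\<^bsub>?G\<^esub> (y \<oplus>\<^bsub>?G\<^esub> z)"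
        by (simp add: f hom S.a_assoc)
    next
      fix x y assume "x \<in> carrier ?G" "y \<in> carrier ?G"
      then obtain f g where f: "f \<in> carrier ?A" "x = symbol f" "g \<in> carrier ?A" "y = symbol g"
        using ex by meson
      show "x \<oplus>\<^bsub>?G\<^esub> y \<in> carrier ?G" by (simp add: f hom)
      show "x \<oplus>\<^bsub>?G\<^esub> y = y \<oplus>\<^bsub>?G\<^esub> x" by (simp add: f hom S.a_comm)
    qed (simp add: zero cl)
    show "Group.comm_monoid ?G"
    proof (rule comm_monoidI)
      fix x y z assume "x \<in> carrier ?G" "y \<in> carrier ?G" "z \<in> carrier ?G"
      then obtain f g h where f: "f \<in> carrier ?A" "x = symbol f" "g \<in> carrier ?A" "y = symbol g"
        "h \<in> carrier ?A" "z = symbol h" using ex by meson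
      show "x \<otimes>\<^bsub>?G\<^esub> y \<otimes>\<^bsub>?G\<^esub> z = x \<otimes>\<^bsub>?G\<^esub> (y \<otimes>\<^bsub>?G\<^esub> z)"
        by (simp add: f hom S.m_assoc)
    next
      fix x y assume "x \<in> carrier ?G" "y \<in> carrier ?G"
      then obtain f g where f: "f \<in> carrier ?A" "x = symbol f" "g \<in> carrier ?A" "y = symbol g"
        using ex by meson
      show "x \<otimes>\<^bsub>?G\<^esub> y \<in> carrier ?G" by (simp add: f hom)
      show "x \<otimes>\<^bsub>?G\<^esub> y = y \<otimes>\<^bsub>?G\<^esub> x" by (simp add: f hom S.m_comm)
    next
      fix x assume "x \<in> carrier ?G"
      then obtain f where f: "f \<in> carrier ?A" "x = symbol f" using ex by blast
      show "\<one>\<^bsub>?G\<^esub> \<otimes>\<^bsub>?G\<^esub> x = x" unfolding one by (simp add: f hom)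
    qed (simp add: one cl)
    fix x y z assume "x \<in> carrier ?G" "y \<in> carrier ?G" "z \<in> carrier ?G"
    then obtain f g h where f: "f \<in> carrier ?A" "x = symbol f" "g \<in> carrier ?A" "y = symbol g"
      "h \<in> carrier ?A" "z = symbol h" using ex by meson
    show "(x \<oplus>\<^bsub>?G\<^esub> y) \<otimes>\<^bsub>?G\<^esub> z = x \<otimes>\<^bsub>?G\<^esub> z \<oplus>\<^bsub>?G\<^esub> y \<otimes>\<^bsub>?G\<^esub> z"
      by (simp add: f hom S.l_distr)
  qed
qed

end

end

theory Submission
  imports Defs
begin

text \<open>
  A splitting \<open>\<phi>\<close> of \<open>R\<close> extends to the polynomial ring by applying it to the coefficients in
  degrees divisible by \<open>p\<close>, i.e. \<open>T\<^sup>m\<^sup>/\<^sup>p\<close> goes to \<open>T\<^sup>n\<close> if \<open>m = n p\<close> and to \<open>0\<close> if \<open>p\<close> does not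
  divide \<open>m\<close>. The hypothesis on \<open>\<phi>\<close> is used twice: since \<open>I\<^sub>(\<^sub>n\<^sub>+\<^sub>1\<^sub>)\<^sub>p \<subseteq> I\<^sub>n\<^sub>p\<^sub>+\<^sub>1\<close>, it shows that
  \<open>\<phi>\<close> maps \<open>(I\<^sub>n\<^sub>p)\<^sup>1\<^sup>/\<^sup>p\<close> to \<open>I\<^sub>n\<close>, so that the extension preserves the Rees algebra; and in its
  original form it shows that the kernel of the projection onto the associated graded ring is
  preserved, so that the splitting descends.
\<close>

section \<open>Frobenius-linear maps and their descent along surjections\<close>

lemma linear_map_frob_iff:
  "linear_map A (frob_module p A) (regular_module A) \<psi> \<longleftrightarrow>
     \<psi> \<in> carrier A \<rightarrow> carrier A \<and>
     (\<forall>x\<in>carrier A. \<forall>y\<in>carrier A. \<psi> (x \<oplus>\<^bsub>A\<^esub> y) = \<psi> x \<oplus>\<^bsub>A\<^esub> \<psi> y) \<and>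
     (\<forall>a\<in>carrier A. \<forall>x\<in>carrier A. \<psi> (a [^]\<^bsub>A\<^esub> p \<otimes>\<^bsub>A\<^esub> x) = a \<otimes>\<^bsub>A\<^esub> \<psi> x)"
  by (simp add: linear_map_def frob_module_def regular_module_def)

text \<open>The bijection \<open>Proot\<close> carries the \<open>R\<close>-module structure of
  \<open>frob_module p R\<close> to that of \<open>proot_ring p R\<close>. Composing with it removes
  formal roots from the rest of the argument.\<close>

lemma splitting_imp_frob_linear:
  fixes R (structure)
  assumes "splitting p R \<phi>"
  defines "\<psi> \<equiv> \<lambda>a. \<phi> (Proot a)"
  shows "linear_map R (frob_module p R) (regular_module R) \<psi>"
    and "a \<in> carrier R \<Longrightarrow> \<psi> (a [^] p) = a"
  using assms
  by (auto simp: splitting_def linear_map_def proot_ring_def frob_module_def regular_module_def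
      proot_emb_def)

text \<open>The splitting on \<open>B\<close> lifts an element to \<open>A\<close>, applies
  \<open>\<psi>\<close> and projects. The last premise makes the result independent of the lift, so
  every identity in \<open>B\<close> can be checked on convenient lifts.\<close>

lemma F_split_surjective_image:
  assumes "ring A"
    and lin: "linear_map A (frob_module p A) (regular_module A) \<psi>"
    and split: "\<And>x. x \<in> carrier A \<Longrightarrow> \<psi> (x [^]\<^bsub>A\<^esub> p) = x"
    and "ring B" and h: "h \<in> ring_hom A B" and surj: "h ` carrier A = carrier B"
    and ker: "\<And>x y. \<lbrakk>x \<in> carrier A; y \<in> carrier A; h x = h y\<rbrakk> \<Longrightarrow> h (\<psi> x) = h (\<psi> y)"
  shows "F_split p B"
proof -
  interpret h: ring_hom_ring A B h
    by (intro ring_hom_ringI2 assms)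
  note lin' = lin[unfolded linear_map_frob_iff]
  have cl: "\<psi> x \<in> carrier A" if "x \<in> carrier A" for x using lin' that by auto
  define \<chi> where "\<chi> y = h (\<psi> (inv_into (carrier A) h y))" for y
  \<comment> \<open>The lift chosen by \<open>inv_into\<close> and \<open>x\<close> have the same
    image under \<open>h\<close>, so \<open>ker\<close> applies to them.\<close>
  have \<chi>: "\<chi> (h x) = h (\<psi> x)" if "x \<in> carrier A" for x
    unfolding \<chi>_def using that by (intro ker) (auto intro: inv_into_into f_inv_into_f)
  have ex: "\<exists>x\<in>carrier A. y = h x" if "y \<in> carrier B" for y
    using that surj by blast
  have "linear_map B (frob_module p B) (regular_module B) \<chi>"
    unfolding linear_map_frob_iff
  proof (intro conjI ballI)
    show "\<chi> \<in> carrier B \<rightarrow> carrier B"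
    proof
      fix y assume "y \<in> carrier B"
      then obtain x where "x \<in> carrier A" "y = h x" using ex by blast
      then show "\<chi> y \<in> carrier B" using \<chi> cl by simp
    qed
  next
    fix x y assume "x \<in> carrier B" "y \<in> carrier B"
    then obtain a b where ab: "a \<in> carrier A" "x = h a" "b \<in> carrier A" "y = h b"
      using ex by meson
    have "\<chi> (x \<oplus>\<^bsub>B\<^esub> y) = \<chi> (h (a \<oplus>\<^bsub>A\<^esub> b))" using ab by simp
    also have "\<dots> = \<chi> x \<oplus>\<^bsub>B\<^esub> \<chi> y"
      using ab lin' cl by (subst \<chi>) (auto simp: \<chi>)
    finally show "\<chi> (x \<oplus>\<^bsub>B\<^esub> y) = \<chi> x \<oplus>\<^bsub>B\<^esub> \<chi> y" .
    have "\<chi> (x [^]\<^bsub>B\<^esub> p \<otimes>\<^bsub>B\<^esub> y) = \<chi> (h (a [^]\<^bsub>A\<^esub> p \<otimes>\<^bsub>A\<^esub> b))"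
      using ab by (simp add: h.hom_nat_pow)
    also have "\<dots> = x \<otimes>\<^bsub>B\<^esub> \<chi> y"
      using ab lin' cl by (subst \<chi>) (auto simp: \<chi>)
    finally show "\<chi> (x [^]\<^bsub>B\<^esub> p \<otimes>\<^bsub>B\<^esub> y) = x \<otimes>\<^bsub>B\<^esub> \<chi> y" .
  qed
  moreover have "\<chi> (y [^]\<^bsub>B\<^esub> p) = y" if y: "y \<in> carrier B" for y
  proof -
    obtain x where x: "x \<in> carrier A" "y = h x" using ex[OF y] by blast
    have "\<chi> (y [^]\<^bsub>B\<^esub> p) = \<chi> (h (x [^]\<^bsub>A\<^esub> p))"
      using x by (simp add: h.hom_nat_pow)
    also have "\<dots> = y" using x split by (subst \<chi>) auto
    finally show ?thesis .
  qed
  ultimately show ?thesis unfolding F_split_def by blast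
qed

section \<open>Frobenius on polynomials\<close>

lemma (in cring) frobenius_finsum:
  assumes p: "Factorial_Ring.prime p" and char: "has_char p R" and f: "f \<in> A \<rightarrow> carrier R"
  shows "(\<Oplus>i\<in>A. f i) [^] p = (\<Oplus>i\<in>A. f i [^] p)"
  using f
proof (induction A rule: infinite_finite_induct)
  case (insert x F)
  then show ?case by (auto simp: frobenius_add[OF p char] Pi_def)
\<comment> \<open>Empty and infinite sums are both \<open>\<zero>\<close>, and
  \<open>\<zero> [^] p = \<zero>\<close> because \<open>p\<close> is positive.\<close>
qed (use prime_gt_0_nat[OF p] in \<open>auto simp: nat_pow_zero\<close>)

lemma (in UP_cring) monom_pow:
  assumes "a \<in> carrier R"
  shows "up_ring.monom P a i [^]\<^bsub>P\<^esub> (k::nat) = up_ring.monom P (a [^] k) (i * k)"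
proof (induction k)
  case (Suc k)
  then show ?case
    using assms monom_mult[of "a [^] k" a "i * k" i] by (simp add: add.commute)
qed simp

text \<open>The constants embed \<open>R\<close> in \<open>P\<close>, so \<open>P\<close> has
  characteristic \<open>p\<close> and Frobenius is additive on it. Applied to \<open>f\<close> as a
  sum of monomials, it turns the term with coefficient \<open>a\<close> in degree \<open>i\<close>
  into the one with coefficient \<open>a [^] p\<close> in degree \<open>i * p\<close>.\<close>

lemma (in UP_cring) coeff_frobenius:
  assumes p: "Factorial_Ring.prime p" and char: "has_char p R" and f: "f \<in> carrier P"
  shows "up_ring.coeff P (f [^]\<^bsub>P\<^esub> p) m =
    (if p dvd m then up_ring.coeff P f (m div p) [^] p else \<zero>)"
proof -
  have p0: "p > 0" using p by (rule prime_gt_0_nat)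
  have charP: "has_char p P"
  proof (rule ring_hom_inj_has_char[OF R.ring_axioms P.ring_axioms _ _ char])
    show "(\<lambda>a. up_ring.monom P a 0) \<in> ring_hom R P" by (rule const_ring_hom)
    show "inj_on (\<lambda>a. up_ring.monom P a 0) (carrier R)" by (rule monom_inj)
  qed
  \<comment> \<open>The bound \<open>deg R f\<close> makes the monomial expansion valid; the bound
    \<open>m\<close> ensures that the index \<open>m div p\<close> lies in the range of
    summation.\<close>
  let ?d = "max (deg R f) m"
  have c: "up_ring.coeff P f i \<in> carrier R" for i using f by simp
  have "f = (\<Oplus>\<^bsub>P\<^esub>i\<in>{..?d}. up_ring.monom P (up_ring.coeff P f i) i)"
    using up_repr_le[OF _ f, of ?d] by simp
  then have "f [^]\<^bsub>P\<^esub> p =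
      (\<Oplus>\<^bsub>P\<^esub>i\<in>{..?d}. up_ring.monom P (up_ring.coeff P f i) i) [^]\<^bsub>P\<^esub> p" by simp
  also have "\<dots> = (\<Oplus>\<^bsub>P\<^esub>i\<in>{..?d}. up_ring.monom P (up_ring.coeff P f i) i [^]\<^bsub>P\<^esub> p)"
    using c by (intro P.frobenius_finsum[OF p charP]) auto
  also have "\<dots> = (\<Oplus>\<^bsub>P\<^esub>i\<in>{..?d}. up_ring.monom P (up_ring.coeff P f i [^] p) (i * p))"
    using c by (simp add: monom_pow)
  finally have "up_ring.coeff P (f [^]\<^bsub>P\<^esub> p) m
      = (\<Oplus>i\<in>{..?d}. up_ring.coeff P (up_ring.monom P (up_ring.coeff P f i [^] p) (i * p)) m)"
    using c by (simp add: coeff_finsum)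
  also have "\<dots> = (\<Oplus>i\<in>{..?d}. if i * p = m then up_ring.coeff P f i [^] p else \<zero>)"
    using c by (intro R.finsum_cong') auto
  also have "\<dots> = (if p dvd m then up_ring.coeff P f (m div p) [^] p else \<zero>)"
  proof (cases "p dvd m")
    case True
    \<comment> \<open>The condition is solved for \<open>i\<close>, which exposes the single index
      that contributes.\<close>
    have "(\<Oplus>i\<in>{..?d}. if i * p = m then up_ring.coeff P f i [^] p else \<zero>)
        = (\<Oplus>i\<in>{..?d}. if m div p = i then up_ring.coeff P f i [^] p else \<zero>)"
      using c p0 True by (intro R.finsum_cong') auto
    also have "\<dots> = up_ring.coeff P f (m div p) [^] p"
      using c by (intro R.finsum_singleton) (auto simp: max_def intro: le_trans[OF div_le_dividend])
    finally show ?thesis using True by simp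
  next
    case False
    then have "(\<Oplus>i\<in>{..?d}. if i * p = m then up_ring.coeff P f i [^] p else \<zero>) = (\<Oplus>i\<in>{..?d}. \<zero>)"
      using c by (intro R.finsum_cong') auto
    then show ?thesis using False by simp
  qed
  finally show ?thesis .
qed

text \<open>This shortens the convolution for coefficient \<open>n * p\<close> of a product with a
  \<open>p\<close>-th power to one of length \<open>n\<close>.\<close>

lemma (in cring) finsum_multiples:
  fixes p n :: nat
  assumes p: "p > 0" and f: "\<And>i. f i \<in> carrier R"
    and z: "\<And>i. \<not> p dvd i \<Longrightarrow> f i = \<zero>"
  shows "(\<Oplus>i\<in>{..n * p}. f i) = (\<Oplus>j\<in>{..n}. f (j * p))"
proof -
  have "(\<Oplus>i\<in>{..n * p}. f i) = (\<Oplus>i\<in>(\<lambda>j. j * p) ` {..n}. f i)"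
  proof (rule add.finprod_mono_neutral_cong_right)
    fix i assume i: "i \<in> {..n * p} - (\<lambda>j. j * p) ` {..n}"
    have "\<not> p dvd i"
    proof
      assume "p dvd i"
      then have j: "i = i div p * p" by simp
      have "i \<in> {..n * p}" using i by (rule DiffD1)
      then have "i div p \<le> n" using div_le_mono[of i "n * p" p] p by simp
      with i j show False by blast
    qed
    then show "f i = \<zero>" by (rule z)
  qed (use f in auto)
  also have "\<dots> = (\<Oplus>j\<in>{..n}. f (j * p))"
    using f p by (intro finsum_reindex) (auto simp: inj_on_def)
  finally show ?thesis .
qed

lemma coeff_UP: "f \<in> carrier (UP R) \<Longrightarrow> up_ring.coeff (UP R) f n = f n"
  by (simp add: UP_def)

section \<open>Splitting of the Rees algebra\<close>

locale frob_split_filtration = cring R for p and R (structure) and I \<psi> +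
  assumes prime: "Factorial_Ring.prime p" and char: "has_char p R"
    and filt: "ideal_filtration R I"
    and linear: "linear_map R (frob_module p R) (regular_module R) \<psi>"
    and split: "a \<in> carrier R \<Longrightarrow> \<psi> (a [^] p) = a"
    and compatible: "a \<in> I (n * p + 1) \<Longrightarrow> \<psi> a \<in> I (n + 1)"
begin

lemma p_pos: "p > 0"
  using prime by (rule prime_gt_0_nat)

lemma in_carrier: "a \<in> I n \<Longrightarrow> a \<in> carrier R"
  by (rule filtration_carrier[OF is_cring filt])

lemma psi_closed: "a \<in> carrier R \<Longrightarrow> \<psi> a \<in> carrier R"
  and psi_add: "a \<in> carrier R \<Longrightarrow> b \<in> carrier R \<Longrightarrow> \<psi> (a \<oplus> b) = \<psi> a \<oplus> \<psi> b"
  and psi_scale: "a \<in> carrier R \<Longrightarrow> b \<in> carrier R \<Longrightarrow> \<psi> (a [^] p \<otimes> b) = a \<otimes> \<psi> b"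
  using linear unfolding linear_map_frob_iff by blast+

lemma psi_zero: "\<psi> \<zero> = \<zero>"
  \<comment> \<open>Since \<open>\<zero> [^] p = \<zero>\<close>, scaling gives
    \<open>\<psi> \<zero> = \<zero> \<otimes> \<psi> \<zero>\<close>.\<close>
  using psi_scale[of \<zero> \<zero>] psi_closed p_pos by (simp add: nat_pow_zero)

lemma psi_finsum:
  assumes "f \<in> A \<rightarrow> carrier R"
  shows "\<psi> (\<Oplus>i\<in>A. f i) = (\<Oplus>i\<in>A. \<psi> (f i))"
  using assms
proof (induction A rule: infinite_finite_induct)
  case (insert x F)
  then show ?case by (auto simp: psi_add psi_closed Pi_def)
qed (auto simp: psi_zero)

lemma filtration_antimono: "m \<le> n \<Longrightarrow> I n \<subseteq> I m"
  using filt lift_Suc_antimono_le[of I m n] by (simp add: ideal_filtration_def)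

lemma psi_filtration:
  assumes "a \<in> I (n * p)"
  shows "\<psi> a \<in> I n"
proof (cases n)
  \<comment> \<open>Compatibility only controls targets of positive index; for index
    \<open>0\<close> the target is the whole ring.\<close>
  case 0
  then show ?thesis
    using assms in_carrier psi_closed filt by (auto simp: ideal_filtration_def)
next
  case (Suc k)
  have "k * p + 1 \<le> n * p" using p_pos Suc by simp
  then have "a \<in> I (k * p + 1)" using filtration_antimono assms by blast
  then show ?thesis using compatible Suc by simp
qed

definition rees_split :: "(nat \<Rightarrow> 'a) \<Rightarrow> nat \<Rightarrow> 'a" where
  "rees_split f = (\<lambda>n. \<psi> (f (n * p)))"

lemma rees_carrier_iff:
  "f \<in> carrier (rees_algebra R I) \<longleftrightarrow> (\<forall>n. f n \<in> I n) \<and> finite {n. f n \<noteq> \<zero>}"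
  by (rule rees_algebra_carrier[OF is_cring filt])

lemma rees_cring: "cring (rees_algebra R I)"
  by (rule rees_algebra_cring[OF is_cring filt])

lemma rees_coeff_closed: "f \<in> carrier (rees_algebra R I) \<Longrightarrow> f n \<in> carrier R"
  using in_carrier by (auto simp: rees_carrier_iff)

lemma rees_frobenius:
  assumes f: "f \<in> carrier (rees_algebra R I)"
  shows "(f [^]\<^bsub>rees_algebra R I\<^esub> p) m = (if p dvd m then f (m div p) [^] p else \<zero>)"
proof -
  interpret U: UP_cring R "UP R" by unfold_locales
  have fU: "f \<in> carrier (UP R)" using f by (simp add: rees_algebra_def)
  \<comment> \<open>The Rees algebra differs from \<open>UP R\<close> only in its carrier, so powers
    are computed identically.\<close>
  have "f [^]\<^bsub>rees_algebra R I\<^esub> p = f [^]\<^bsub>UP R\<^esub> p"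
    by (simp add: rees_algebra_def nat_pow_def)
  then show ?thesis
    using U.coeff_frobenius[OF prime char fU, of m] fU by (simp add: coeff_UP)
qed

lemma rees_split_closed:
  assumes f: "f \<in> carrier (rees_algebra R I)"
  shows "rees_split f \<in> carrier (rees_algebra R I)"
proof -
  \<comment> \<open>As \<open>\<psi> \<zero> = \<zero>\<close>, the new support lies in the preimage
    of the old one under this injection, hence is finite.\<close>
  have "inj (\<lambda>n. n * p)" using p_pos by (auto simp: inj_on_def)
  then have "finite ((\<lambda>n. n * p) -` {n. f n \<noteq> \<zero>})"
    using f by (intro finite_vimageI) (auto simp: rees_carrier_iff)
  moreover have "{n. rees_split f n \<noteq> \<zero>} \<subseteq> (\<lambda>n. n * p) -` {n. f n \<noteq> \<zero>}"
    by (auto simp: rees_split_def psi_zero)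
  ultimately have "finite {n. rees_split f n \<noteq> \<zero>}" using finite_subset by blast
  then show ?thesis
    using f psi_filtration by (simp add: rees_carrier_iff) (simp add: rees_split_def)
qed

text \<open>In coefficient \<open>n * p\<close> of the product of \<open>f\<close> to the power
  \<open>p\<close> with \<open>g\<close>, only the indices \<open>j * p\<close> contribute, with
  terms \<open>f j [^] p \<otimes> g ((n - j) * p)\<close>. Pulling each \<open>f j\<close> out of
  \<open>\<psi>\<close> leaves the convolution of \<open>f\<close> with
  \<open>rees_split g\<close>.\<close>

lemma rees_split_linear:
  "linear_map (rees_algebra R I) (frob_module p (rees_algebra R I))
     (regular_module (rees_algebra R I)) rees_split"
  unfolding linear_map_frob_iff
proof (intro conjI ballI)
  let ?A = "rees_algebra R I"
  interpret A: cring ?A by (rule rees_cring)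
  have up: "f \<in> up R" if "f \<in> carrier ?A" for f using that by (simp add: rees_algebra_simps(1))
  show "rees_split \<in> carrier ?A \<rightarrow> carrier ?A" using rees_split_closed by blast
  fix f g assume f: "f \<in> carrier ?A" and g: "g \<in> carrier ?A"
  note c = rees_coeff_closed[OF f] rees_coeff_closed[OF g]
  note up' = up[OF f] up[OF g] up[OF rees_split_closed[OF f]] up[OF rees_split_closed[OF g]]
  show "rees_split (f \<oplus>\<^bsub>?A\<^esub> g) = rees_split f \<oplus>\<^bsub>?A\<^esub> rees_split g"
    using c by (simp only: rees_algebra_simps(3) up') (simp add: rees_split_def psi_add)
  have fp: "f [^]\<^bsub>?A\<^esub> p \<in> carrier ?A" using f by simp
  show "rees_split (f [^]\<^bsub>?A\<^esub> p \<otimes>\<^bsub>?A\<^esub> g) = f \<otimes>\<^bsub>?A\<^esub> rees_split g"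
  proof
    fix n
    let ?t = "\<lambda>i. (f [^]\<^bsub>?A\<^esub> p) i \<otimes> g (n * p - i)"
    have "rees_split (f [^]\<^bsub>?A\<^esub> p \<otimes>\<^bsub>?A\<^esub> g) n = \<psi> (\<Oplus>i\<in>{..n * p}. ?t i)"
      by (simp only: rees_split_def rees_algebra_simps(2)[OF up[OF fp] up'(2)])
    also have "(\<Oplus>i\<in>{..n * p}. ?t i) = (\<Oplus>j\<in>{..n}. ?t (j * p))"
      using c p_pos by (intro finsum_multiples) (auto simp: rees_frobenius[OF f])
    also have "\<dots> = (\<Oplus>j\<in>{..n}. f j [^] p \<otimes> g ((n - j) * p))"
      using c p_pos
      by (intro finsum_cong') (auto simp: rees_frobenius[OF f] diff_mult_distrib)
    also have "\<psi> \<dots> = (\<Oplus>j\<in>{..n}. f j \<otimes> rees_split g (n - j))"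
      using c by (subst psi_finsum) (auto simp: psi_scale rees_split_def)
    also have "\<dots> = (f \<otimes>\<^bsub>?A\<^esub> rees_split g) n"
      by (simp only: rees_algebra_simps(2)[OF up'(1) up'(4)])
    finally show "rees_split (f [^]\<^bsub>?A\<^esub> p \<otimes>\<^bsub>?A\<^esub> g) n = (f \<otimes>\<^bsub>?A\<^esub> rees_split g) n" .
  qed
qed

lemma rees_split_frobenius:
  assumes f: "f \<in> carrier (rees_algebra R I)"
  shows "rees_split (f [^]\<^bsub>rees_algebra R I\<^esub> p) = f"
  using rees_coeff_closed[OF f] p_pos
  by (auto simp: rees_split_def rees_frobenius[OF f] split)

lemma F_split_rees: "F_split p (rees_algebra R I)"
  unfolding F_split_def using rees_split_linear rees_split_frobenius by blast

section \<open>Descent to the associated graded ring\<close>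

text \<open>This is the independence of the lift required by
  \<open>F_split_surjective_image\<close>. Equal symbols in degree \<open>n * p\<close> mean a
  difference in \<open>I (n * p + 1)\<close>, which \<open>\<psi>\<close> sends into
  \<open>I (n + 1)\<close>, the ideal divided out in degree \<open>n\<close>.\<close>

lemma symbol_rees_split_cong:
  assumes f: "f \<in> carrier (rees_algebra R I)" and g: "g \<in> carrier (rees_algebra R I)"
    and eq: "symbol R I f = symbol R I g"
  shows "symbol R I (rees_split f) = symbol R I (rees_split g)"
proof
  fix n
  interpret J: ideal "I m" R for m by (rule filtration_ideal[OF is_cring filt])
  note c = rees_coeff_closed[OF f, of "n * p"] rees_coeff_closed[OF g, of "n * p"]
  have "I (n * p + 1) +> f (n * p) = I (n * p + 1) +> g (n * p)"
    using fun_cong[OF eq, of "n * p"] by (simp only: symbol_def[OF is_cring filt])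
  then have "f (n * p) \<in> I (n * p + 1) +> g (n * p)"
    using J.a_rcos_self[OF c(1)] by blast
  then obtain h where h: "h \<in> I (n * p + 1)" "f (n * p) = h \<oplus> g (n * p)"
    by (auto simp: a_r_coset_def')
  have "\<psi> (f (n * p)) = \<psi> h \<oplus> \<psi> (g (n * p))"
    using h in_carrier c by (simp add: psi_add del: add_Suc_right One_nat_def)
  then have "\<psi> (f (n * p)) \<in> I (n + 1) +> \<psi> (g (n * p))"
    using compatible[OF h(1)] by (auto simp: a_r_coset_def')
  then have "I (n + 1) +> \<psi> (f (n * p)) = I (n + 1) +> \<psi> (g (n * p))"
    using a_repr_independence[OF _ psi_closed[OF c(2)] J.a_subgroup] by metis
  then show "symbol R I (rees_split f) n = symbol R I (rees_split g) n"
    by (simp only: symbol_def[OF is_cring filt] rees_split_def)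
qed

lemma F_split_assoc_graded: "F_split p (assoc_graded R I)"
proof (rule F_split_surjective_image[OF _ rees_split_linear rees_split_frobenius])
  let ?A = "rees_algebra R I"
  interpret A: cring ?A by (rule rees_cring)
  note hom = symbol_hom[OF is_cring filt]
  show "ring ?A" by (rule A.ring_axioms)
  show "ring (assoc_graded R I)"
    by (rule cring.axioms(1)[OF assoc_graded_cring[OF is_cring filt]])
  show im: "symbol R I ` carrier ?A = carrier (assoc_graded R I)"
    by (rule symbol_image[OF is_cring filt])
  show "symbol R I \<in> ring_hom ?A (assoc_graded R I)"
    by (rule ring_hom_memI)
      (use im hom(3)[OF A.one_closed A.one_closed] in \<open>auto simp: hom(1,2)\<close>)
qed (assumption | erule (2) symbol_rees_split_cong)+

end

section \<open>The local and graded cases together\<close>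

lemma graded_imp_F_split_filtration:
  "graded_F_split_filtration p R G I \<Longrightarrow> F_split_filtration p R I"
  unfolding graded_F_split_filtration_def F_split_filtration_def by blast

theorem theorem4p7:
  fixes R :: "('a, 'm) ring_scheme" and p :: nat
    and G :: "nat \<Rightarrow> 'a set" and I :: "nat \<Rightarrow> 'a set"
  assumes "Factorial_Ring.prime p"
    and "cring R"
    and "has_char p R"
    and "noetherian_ring R"
    and "F_finite p R"
    and "F_split p R"
    and "(local_ring R \<and> F_split_filtration p R I) \<or>
         (standard_graded_local R G \<and> graded_F_split_filtration p R G I)"
  shows "F_split p (rees_algebra R I) \<and> F_split p (assoc_graded R I)"
proof -
  have "F_split_filtration p R I"
    using assms(7) graded_imp_F_split_filtration by blast
  then obtain \<phi> where filt: "ideal_filtration R I" and \<phi>: "splitting p R \<phi>"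
    and compatible: "splits_filtration p I \<phi>"
    unfolding F_split_filtration_def by blast
  interpret cring R by fact
  \<comment> \<open>Both cases now provide the same data: a splitting compatible with the
    filtration, read on \<open>R\<close> itself through \<open>Proot\<close>.\<close>
  interpret frob_split_filtration p R I "\<lambda>a. \<phi> (Proot a)"
  proof
    show "\<phi> (Proot a) \<in> I (n + 1)" if "a \<in> I (n * p + 1)" for a n
      using compatible that unfolding splits_filtration_def by blast
  qed (use assms(1,3) filt splitting_imp_frob_linear[OF \<phi>] in auto)
  show ?thesis using F_split_rees F_split_assoc_graded by blast
qed

end
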